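(* For arbitrary pointed simplicial models $(\mathcal C,X)$ and $(\mathcal C',X')$, \[ (\mathcal C,X)\mathrel{\underline{\leftrightarrow}}(\mathcal C',X') \quad\Longrightarrow\quad (\mathcal C,X)\equiv_{\mathcal L^+}(\mathcal C',X'). \]
   Context: Let $A$ be a finite set of agents and, for each $a\in A$, $P_a$ a countable set of local atoms (mutually disjoint). The language $\mathcal L^+$ is $\varphi ::= a \mid p_a \mid \neg\varphi \mid (\varphi\wedge\varphi)\mid \widehat K_a\varphi$ with $a\in A$ (global atom "agent $a$ is alive") and $p_a\in P_a$. A simplicial model $\mathcal C=(C,\chi,\ell)$ consists of a nonempty downward-closed set $C$ of nonempty finite subsets (simplexes) of a vertex set containing all singletons, a chromatic map $\chi$ from vertices to agents injective on each simplex, and a valuation $\ell$ assigning to each vertex $v$ a subset of $P_{\chi(v)}$; $\chi(X)$ and $\ell(X)$ are the unions over vertices of $X$; $\mathcal F(C)$ is the set of facets (maximal simplexes); a pointed model is $(\mathcal C,X)$ with $X\in\mathcal F(C)$. Three-valued semantics on facets: definability $\bowtie$: $a$ always defined; $p_a$ defined iff $a\in\chi(X)$; $\neg\varphi$ defined iff $\varphi$ is; $\varphi\wedge\psi$ defined iff both are; $\widehat K_a\varphi$ defined iff $\varphi$ is defined in some facet $Y$ with $a\in\chi(X\cap Y)$. Truth $\vDash$: $a$ true iff $a\in\chi(X)$; $p_a$ true iff $p_a\in\ell(X)$; $\neg\varphi$ true iff $\varphi$ defined and not true; $\varphi\wedge\psi$ true iff both true; $\widehat K_a\varphi$ true iff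 $\varphi$ true in some facet $Y$ with $a\in\chi(X\cap Y)$. $(\mathcal C,X)\equiv_{\mathcal L^+}(\mathcal C',X')$ means that for every $\varphi\in\mathcal L^+$, $\varphi$ is defined/true/has true negation in $(\mathcal C,X)$ iff the same holds in $(\mathcal C',X')$. A bisimulation between $\mathcal C$ and $\mathcal C'$ is a nonempty relation $\mathcal B\subseteq\mathcal F(C)\times\mathcal F(C')$ such that whenever $X\mathcal B X'$: (atoms) $\chi(X)=\chi'(X')$ and $\ell(X)=\ell'(X')$; (forth) for each $a$ and each facet $Y$ with $a\in\chi(X\cap Y)$ there is a facet $Y'$ with $a\in\chi'(X'\cap Y')$ and $Y\mathcal B Y'$; (back) symmetrically. $(\mathcal C,X)\mathrel{\underline{\leftrightarrow}}(\mathcal C',X')$ means there is a bisimulation relating $X$ and $X'$. *)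

theory Defs
  imports "HOL-Library.Countable_Set" "HOL-Library.Disjoint_Sets"
begin

text \<open>
  \<open>A\<close> is the set of agents and \<open>P a\<close> the set of local atoms of agent \<open>a\<close>.
\<close>

definition signature :: "'a set \<Rightarrow> ('a \<Rightarrow> 'p set) \<Rightarrow> bool" where
  "signature A P \<longleftrightarrow>
     finite A \<and> (\<forall>a\<in>A. countable (P a)) \<and> disjoint_family_on P A"

text \<open>
  \<open>Local a p\<close> is the local atom \<open>p\<^sub>a\<close>; the index \<open>a\<close> is its owner, which disjointness of the
  sets \<open>P a\<close> makes unique for formulas of the language.
\<close>

datatype ('a, 'p) formula =
    Alive 'a
  | Local 'a 'p
  | Neg "('a, 'p) formula"
  | Conj "('a, 'p) formula" "('a, 'p) formula"
  | Khat 'a "('a, 'p) formula"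

inductive_set language :: "'a set \<Rightarrow> ('a \<Rightarrow> 'p set) \<Rightarrow> ('a, 'p) formula set"
  for A :: "'a set" and P :: "'a \<Rightarrow> 'p set" where
  Alive: "a \<in> A \<Longrightarrow> Alive a \<in> language A P"
| Local: "a \<in> A \<Longrightarrow> p \<in> P a \<Longrightarrow> Local a p \<in> language A P"
| Neg: "\<phi> \<in> language A P \<Longrightarrow> Neg \<phi> \<in> language A P"
| Conj: "\<phi> \<in> language A P \<Longrightarrow> \<psi> \<in> language A P \<Longrightarrow> Conj \<phi> \<psi> \<in> language A P"
| Khat: "a \<in> A \<Longrightarrow> \<phi> \<in> language A P \<Longrightarrow> Khat a \<phi> \<in> language A P"

text \<open>
  The maps \<open>colour\<close> (\<open>\<chi>\<close>) and \<open>valuation\<close> (\<open>\<ell>\<close>) are only meaningful on \<open>vertices\<close>.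
\<close>

record ('v, 'a, 'p) model =
  vertices :: "'v set"
  simplexes :: "'v set set"
  colour :: "'v \<Rightarrow> 'a"
  valuation :: "'v \<Rightarrow> 'p set"

definition simplicial_model ::
  "'a set \<Rightarrow> ('a \<Rightarrow> 'p set) \<Rightarrow> ('v, 'a, 'p) model \<Rightarrow> bool" where
  "simplicial_model A P M \<longleftrightarrow>
     simplexes M \<noteq> {} \<and>
     (\<forall>X\<in>simplexes M. X \<noteq> {} \<and> finite X \<and> X \<subseteq> vertices M) \<and>
     (\<forall>X\<in>simplexes M. \<forall>Y. Y \<noteq> {} \<and> Y \<subseteq> X \<longrightarrow> Y \<in> simplexes M) \<and>
     (\<forall>v\<in>vertices M. {v} \<in> simplexes M) \<and>
     (\<forall>v\<in>vertices M. colour M v \<in> A) \<and>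
     (\<forall>X\<in>simplexes M. inj_on (colour M) X) \<and>
     (\<forall>v\<in>vertices M. valuation M v \<subseteq> P (colour M v))"

definition colours :: "('v, 'a, 'p) model \<Rightarrow> 'v set \<Rightarrow> 'a set" where
  "colours M X = colour M ` X"

definition valuations :: "('v, 'a, 'p) model \<Rightarrow> 'v set \<Rightarrow> 'p set" where
  "valuations M X = (\<Union>v\<in>X. valuation M v)"

definition facets :: "('v, 'a, 'p) model \<Rightarrow> 'v set set" where
  "facets M = {X \<in> simplexes M. \<forall>Y\<in>simplexes M. X \<subseteq> Y \<longrightarrow> Y = X}"

definition pointed_model ::
  "'a set \<Rightarrow> ('a \<Rightarrow> 'p set) \<Rightarrow> ('v, 'a, 'p) model \<Rightarrow> 'v set \<Rightarrow> bool" where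
  "pointed_model A P M X \<longleftrightarrow> simplicial_model A P M \<and> X \<in> facets M"

primrec is_defined :: "('v, 'a, 'p) model \<Rightarrow> 'v set \<Rightarrow> ('a, 'p) formula \<Rightarrow> bool" where
  "is_defined M X (Alive a) \<longleftrightarrow> True"
| "is_defined M X (Local a p) \<longleftrightarrow> a \<in> colours M X"
| "is_defined M X (Neg \<phi>) \<longleftrightarrow> is_defined M X \<phi>"
| "is_defined M X (Conj \<phi> \<psi>) \<longleftrightarrow> is_defined M X \<phi> \<and> is_defined M X \<psi>"
| "is_defined M X (Khat a \<phi>) \<longleftrightarrow>
     (\<exists>Y\<in>facets M. a \<in> colours M (X \<inter> Y) \<and> is_defined M Y \<phi>)"

primrec is_true :: "('v, 'a, 'p) model \<Rightarrow> 'v set \<Rightarrow> ('a, 'p) formula \<Rightarrow> bool" where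
  "is_true M X (Alive a) \<longleftrightarrow> a \<in> colours M X"
| "is_true M X (Local a p) \<longleftrightarrow> p \<in> valuations M X"
| "is_true M X (Neg \<phi>) \<longleftrightarrow> is_defined M X \<phi> \<and> \<not> is_true M X \<phi>"
| "is_true M X (Conj \<phi> \<psi>) \<longleftrightarrow> is_true M X \<phi> \<and> is_true M X \<psi>"
| "is_true M X (Khat a \<phi>) \<longleftrightarrow>
     (\<exists>Y\<in>facets M. a \<in> colours M (X \<inter> Y) \<and> is_true M Y \<phi>)"

definition modally_equivalent ::
  "'a set \<Rightarrow> ('a \<Rightarrow> 'p set) \<Rightarrow> ('v, 'a, 'p) model \<Rightarrow> 'v set \<Rightarrow>
   ('w, 'a, 'p) model \<Rightarrow> 'w set \<Rightarrow> bool" where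
  "modally_equivalent A P M X M' X' \<longleftrightarrow>
     (\<forall>\<phi>\<in>language A P.
        (is_defined M X \<phi> \<longleftrightarrow> is_defined M' X' \<phi>) \<and>
        (is_true M X \<phi> \<longleftrightarrow> is_true M' X' \<phi>) \<and>
        (is_true M X (Neg \<phi>) \<longleftrightarrow> is_true M' X' (Neg \<phi>)))"

definition bisimulation ::
  "'a set \<Rightarrow> ('v, 'a, 'p) model \<Rightarrow> ('w, 'a, 'p) model \<Rightarrow> ('v set \<times> 'w set) set \<Rightarrow> bool" where
  "bisimulation A M M' B \<longleftrightarrow>
     B \<noteq> {} \<and> B \<subseteq> facets M \<times> facets M' \<and>
     (\<forall>(X, X')\<in>B.
        colours M X = colours M' X' \<and> valuations M X = valuations M' X' \<and>
        (\<forall>a\<in>A. \<forall>Y\<in>facets M. a \<in> colours M (X \<inter> Y) \<longrightarrow>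
           (\<exists>Y'\<in>facets M'. a \<in> colours M' (X' \<inter> Y') \<and> (Y, Y') \<in> B)) \<and>
        (\<forall>a\<in>A. \<forall>Y'\<in>facets M'. a \<in> colours M' (X' \<inter> Y') \<longrightarrow>
           (\<exists>Y\<in>facets M. a \<in> colours M (X \<inter> Y) \<and> (Y, Y') \<in> B)))"

definition bisimilar ::
  "'a set \<Rightarrow> ('v, 'a, 'p) model \<Rightarrow> 'v set \<Rightarrow> ('w, 'a, 'p) model \<Rightarrow> 'w set \<Rightarrow> bool" where
  "bisimilar A M X M' X' \<longleftrightarrow> (\<exists>B. bisimulation A M M' B \<and> (X, X') \<in> B)"

end

theory Submission
  imports Defs
begin

text \<open>Structural induction on the formula, over all pairs of a fixed bisimulation
  \<open>B\<close> at once: agreement of colours and valuations settles the atoms, and for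
  \<open>Khat\<close> a witnessing facet is carried across by forth or back to a facet paired with
  it in \<open>B\<close>, where the induction hypothesis applies.
  \<open>bisimulation_preserves\<close> is this induction.\<close>

lemma bisimulationD:
  assumes "bisimulation A M M' B" and "(X, X') \<in> B"
  shows "colours M X = colours M' X'" and "valuations M X = valuations M' X'"
    and "\<And>a Y. \<lbrakk>a \<in> A; Y \<in> facets M; a \<in> colours M (X \<inter> Y)\<rbrakk> \<Longrightarrow>
      \<exists>Y'\<in>facets M'. a \<in> colours M' (X' \<inter> Y') \<and> (Y, Y') \<in> B"
    and "\<And>a Y'. \<lbrakk>a \<in> A; Y' \<in> facets M'; a \<in> colours M' (X' \<inter> Y')\<rbrakk> \<Longrightarrow>
      \<exists>Y\<in>facets M. a \<in> colours M (X \<inter> Y) \<and> (Y, Y') \<in> B"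
  using assms unfolding bisimulation_def by blast+

text \<open>Definedness and truth go through one induction because the truth of \<open>Neg\<close>
  refers to definedness.\<close>

lemma bisimulation_preserves:
  assumes "bisimulation A M M' B" and "\<phi> \<in> language A P" and "(X, X') \<in> B"
  shows "(is_defined M X \<phi> \<longleftrightarrow> is_defined M' X' \<phi>) \<and> (is_true M X \<phi> \<longleftrightarrow> is_true M' X' \<phi>)"
  using assms(2,3)
proof (induction arbitrary: X X')
  case (Khat a \<phi>)
  \<comment> \<open>Induction over \<open>language\<close> supplies \<open>a \<in> A\<close>, which
    forth and back require.\<close>
  note zig = bisimulationD(3)[OF assms(1) Khat.prems Khat.hyps(1)]
    and zag = bisimulationD(4)[OF assms(1) Khat.prems Khat.hyps(1)]
  have "is_defined M X (Khat a \<phi>) \<longleftrightarrow> is_defined M' X' (Khat a \<phi>)"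
    unfolding is_defined.simps using zig zag Khat.IH by blast
  moreover have "is_true M X (Khat a \<phi>) \<longleftrightarrow> is_true M' X' (Khat a \<phi>)"
    unfolding is_true.simps using zig zag Khat.IH by blast
  ultimately show ?case ..
qed (simp_all add: bisimulationD(1,2)[OF assms(1)])

theorem theorem4p2:
  fixes A :: "'a set" and P :: "'a \<Rightarrow> 'p set"
    and M :: "('v, 'a, 'p) model" and X :: "'v set"
    and M' :: "('w, 'a, 'p) model" and X' :: "'w set"
  assumes "signature A P"
    and "pointed_model A P M X" and "pointed_model A P M' X'"
    and "bisimilar A M X M' X'"
  shows "modally_equivalent A P M X M' X'"
proof -
  obtain B where "bisimulation A M M' B" "(X, X') \<in> B"
    using assms(4) unfolding bisimilar_def by blast
  then show ?thesis
    \<comment> \<open>The clause on \<open>Neg\<close> unfolds to definedness and truth of the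
      formula itself.\<close>
    unfolding modally_equivalent_def by (simp add: bisimulation_preserves)
qed

end
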